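(* There exists an approximately unital commutative weakly compact semisimple operator algebra $A$ whose spectrum (maximal ideal space) is neither countable nor scattered; in fact such an $A$ can be found containing an element whose spectrum has nonempty interior in $\mathbb{C}$.
   Context: An operator algebra is a norm-closed subalgebra of $B(H)$ for a Hilbert space $H$. It is approximately unital if it has a contractive approximate identity. A Banach algebra $A$ is weakly compact if for every $a \in A$ the map $A \to A$, $x \mapsto axa$, is a weakly compact operator. A topological space is scattered if every nonempty subset has a relatively isolated point. *)

theory Defs
  imports "HOL-Analysis.Analysis"
begin

section \<open>Complex Hilbert spaces\<close>

text \<open>The real structure (norm, metric, real inner product) is that of the class
  \<^class>\<open>real_inner\<close>; the complex inner product is linear in its first argument.\<close>

class chilbert_space = real_inner + complete_space +
  fixes scaleC :: "complex \<Rightarrow> 'a \<Rightarrow> 'a" (infixr \<open>*\<^sub>C\<close> 75)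
    and cinner :: "'a \<Rightarrow> 'a \<Rightarrow> complex"
  assumes scaleC_add_right: "c *\<^sub>C (x + y) = c *\<^sub>C x + c *\<^sub>C y"
    and scaleC_add_left: "(c + d) *\<^sub>C x = c *\<^sub>C x + d *\<^sub>C x"
    and scaleC_scaleC: "c *\<^sub>C d *\<^sub>C x = (c * d) *\<^sub>C x"
    and scaleR_eq_scaleC: "r *\<^sub>R x = complex_of_real r *\<^sub>C x"
    and cinner_commute: "cinner x y = cnj (cinner y x)"
    and cinner_add_left: "cinner (x + y) z = cinner x z + cinner y z"
    and cinner_scaleC_left: "cinner (c *\<^sub>C x) y = c * cinner x y"
    and inner_eq_Re_cinner: "inner x y = Re (cinner x y)"

lemma norm_scaleC: "norm (c *\<^sub>C x) = cmod c * norm (x::'a::chilbert_space)"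
proof -
  have c: "cinner y y = complex_of_real ((norm y)\<^sup>2)" for y :: 'a
    using cinner_commute[of y y] inner_eq_Re_cinner[of y y]
    by (simp add: complex_eq_iff power2_norm_eq_inner)
  have "cinner (c *\<^sub>C x) (c *\<^sub>C x) = c * cnj (c * cinner x x)"
    using cinner_commute[of x "c *\<^sub>C x"] by (simp add: cinner_scaleC_left)
  also have "\<dots> = complex_of_real ((cmod c * norm x)\<^sup>2)"
    by (simp add: c power_mult_distrib complex_norm_square flip: of_real_power)
  finally have "(norm (c *\<^sub>C x))\<^sup>2 = (cmod c * norm x)\<^sup>2"
    unfolding c of_real_eq_iff .
  then show ?thesis by simp
qed

lemma bounded_linear_scaleC: "bounded_linear (\<lambda>x::'a::chilbert_space. c *\<^sub>C x)"
  by (rule bounded_linear_intro[where K = "cmod c"])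
    (simp_all add: scaleC_add_right scaleR_eq_scaleC scaleC_scaleC norm_scaleC mult.commute)


section \<open>The Hilbert space of square-summable sequences\<close>

typedef ell2 = "{f :: nat \<Rightarrow> complex. summable (\<lambda>n. (cmod (f n))\<^sup>2)}"
  by (rule exI[of _ "\<lambda>_. 0"]) simp

setup_lifting type_definition_ell2

lemma ell2_add:
  assumes "summable (\<lambda>n. (cmod (f n))\<^sup>2)" "summable (\<lambda>n. (cmod (g n))\<^sup>2)"
  shows "summable (\<lambda>n. (cmod (f n + g n))\<^sup>2)"
proof (rule summable_comparison_test')
  show "summable (\<lambda>n. 2 * (cmod (f n))\<^sup>2 + 2 * (cmod (g n))\<^sup>2)"
    using assms by (intro summable_add summable_mult)
  fix n
  have "(cmod (f n + g n))\<^sup>2 \<le> (cmod (f n) + cmod (g n))\<^sup>2"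
    by (intro power_mono norm_triangle_ineq) simp
  also have "\<dots> \<le> 2 * (cmod (f n))\<^sup>2 + 2 * (cmod (g n))\<^sup>2"
    using sum_squares_bound[of "cmod (f n)" "cmod (g n)"]
    by (simp add: power2_sum)
  finally show "norm ((cmod (f n + g n))\<^sup>2) \<le> 2 * (cmod (f n))\<^sup>2 + 2 * (cmod (g n))\<^sup>2"
    by simp
qed

lemma ell2_scale:
  assumes "summable (\<lambda>n. (cmod (f n))\<^sup>2)"
  shows "summable (\<lambda>n. (cmod (c * f n))\<^sup>2)"
  using summable_mult[OF assms, of "(cmod c)\<^sup>2"] by (simp add: norm_mult power_mult_distrib)

lemma ell2_mult_cnj:
  assumes "summable (\<lambda>n. (cmod (f n))\<^sup>2)" "summable (\<lambda>n. (cmod (g n))\<^sup>2)"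
  shows "summable (\<lambda>n. f n * cnj (g n))"
proof (rule summable_comparison_test')
  show "summable (\<lambda>n. (cmod (f n))\<^sup>2 + (cmod (g n))\<^sup>2)"
    using assms by (rule summable_add)
  fix n
  have "0 \<le> cmod (f n) * cmod (g n)" by simp
  then show "norm (f n * cnj (g n)) \<le> (cmod (f n))\<^sup>2 + (cmod (g n))\<^sup>2"
    using sum_squares_bound[of "cmod (f n)" "cmod (g n)"]
    unfolding norm_mult complex_mod_cnj by linarith
qed

instantiation ell2 :: real_inner
begin

lift_definition zero_ell2 :: ell2 is "\<lambda>_. 0" by simp

lift_definition plus_ell2 :: "ell2 \<Rightarrow> ell2 \<Rightarrow> ell2" is "\<lambda>f g n. f n + g n"
  by (rule ell2_add)

lift_definition uminus_ell2 :: "ell2 \<Rightarrow> ell2" is "\<lambda>f n. - f n" by simp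

lift_definition minus_ell2 :: "ell2 \<Rightarrow> ell2 \<Rightarrow> ell2" is "\<lambda>f g n. f n - g n"
  subgoal for f g using ell2_add[of f "\<lambda>n. - g n"] by simp
  done

lift_definition scaleR_ell2 :: "real \<Rightarrow> ell2 \<Rightarrow> ell2" is "\<lambda>r f n. complex_of_real r * f n"
  by (rule ell2_scale)

lift_definition inner_ell2 :: "ell2 \<Rightarrow> ell2 \<Rightarrow> real" is "\<lambda>f g. Re (\<Sum>n. f n * cnj (g n))" .

definition norm_ell2 :: "ell2 \<Rightarrow> real" where "norm_ell2 x = sqrt (inner x x)"

definition sgn_ell2 :: "ell2 \<Rightarrow> ell2" where "sgn_ell2 x = inverse (norm x) *\<^sub>R x"

definition dist_ell2 :: "ell2 \<Rightarrow> ell2 \<Rightarrow> real" where "dist_ell2 x y = norm (x - y)"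

definition uniformity_ell2 :: "(ell2 \<times> ell2) filter" where
  "uniformity_ell2 = (INF e\<in>{0<..}. principal {(x, y). dist x y < e})"

definition open_ell2 :: "ell2 set \<Rightarrow> bool" where
  "open_ell2 U = (\<forall>x\<in>U. eventually (\<lambda>(x', y). x' = x \<longrightarrow> y \<in> U) uniformity)"

lemma ell2_inner_same:
  assumes "summable (\<lambda>n. (cmod (f n))\<^sup>2)"
  shows "Re (\<Sum>n. f n * cnj (f n)) = (\<Sum>n. (cmod (f n))\<^sup>2)"
proof -
  have "(\<lambda>n. f n * cnj (f n)) = (\<lambda>n. complex_of_real ((cmod (f n))\<^sup>2))"
    by (auto simp: complex_norm_square simp del: of_real_power)
  then show ?thesis using suminf_of_real[OF assms, where ?'a = complex] by (metis Re_complex_of_real)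
qed

instance
proof
  fix x y z :: ell2 and r s :: real
  show "x + y + z = x + (y + z)" by transfer (simp add: add.assoc)
  show "x + y = y + x" by transfer (simp add: add.commute)
  show "0 + x = x" by transfer simp
  show "- x + x = 0" by transfer simp
  show "x - y = x + - y" by transfer simp
  show "r *\<^sub>R (x + y) = r *\<^sub>R x + r *\<^sub>R y" by transfer (simp add: algebra_simps)
  show "(r + s) *\<^sub>R x = r *\<^sub>R x + s *\<^sub>R x" by transfer (simp add: algebra_simps)
  show "r *\<^sub>R s *\<^sub>R x = (r * s) *\<^sub>R x" by transfer (simp add: algebra_simps)
  show "1 *\<^sub>R x = x" by transfer simp
  show "sgn x = inverse (norm x) *\<^sub>R x" by (rule sgn_ell2_def)
  show "dist x y = norm (x - y)" by (rule dist_ell2_def)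
  show "uniformity = (INF e\<in>{0<..}. principal {(x, y::ell2). dist x y < e})"
    by (rule uniformity_ell2_def)
  show "open U = (\<forall>x\<in>U. eventually (\<lambda>(x', y). x' = x \<longrightarrow> y \<in> U) uniformity)" for U :: "ell2 set"
    by (rule open_ell2_def)
  show "norm x = sqrt (inner x x)" by (rule norm_ell2_def)
  show "inner x y = inner y x"
  proof transfer
    fix f g :: "nat \<Rightarrow> complex"
    assume f: "summable (\<lambda>n. (cmod (f n))\<^sup>2)" and g: "summable (\<lambda>n. (cmod (g n))\<^sup>2)"
    show "Re (\<Sum>n. f n * cnj (g n)) = Re (\<Sum>n. g n * cnj (f n))"
      unfolding Re_suminf[OF ell2_mult_cnj[OF f g]] Re_suminf[OF ell2_mult_cnj[OF g f]]
      by (simp add: mult.commute)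
  qed
  show "inner (x + y) z = inner x z + inner y z"
  proof transfer
    fix f g h :: "nat \<Rightarrow> complex"
    assume f: "summable (\<lambda>n. (cmod (f n))\<^sup>2)" and g: "summable (\<lambda>n. (cmod (g n))\<^sup>2)"
      and h: "summable (\<lambda>n. (cmod (h n))\<^sup>2)"
    show "Re (\<Sum>n. (f n + g n) * cnj (h n))
        = Re (\<Sum>n. f n * cnj (h n)) + Re (\<Sum>n. g n * cnj (h n))"
      using suminf_add[OF ell2_mult_cnj[OF f h] ell2_mult_cnj[OF g h]]
      by (simp add: distrib_right flip: plus_complex.simps)
  qed
  show "inner (r *\<^sub>R x) y = r * inner x y"
  proof transfer
    fix r :: real and f g :: "nat \<Rightarrow> complex"
    assume f: "summable (\<lambda>n. (cmod (f n))\<^sup>2)" and g: "summable (\<lambda>n. (cmod (g n))\<^sup>2)"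
    show "Re (\<Sum>n. complex_of_real r * f n * cnj (g n)) = r * Re (\<Sum>n. f n * cnj (g n))"
      using suminf_mult[OF ell2_mult_cnj[OF f g], of "complex_of_real r"]
      by (simp add: mult.assoc)
  qed
  show "0 \<le> inner x x"
    by transfer (simp add: ell2_inner_same suminf_nonneg)
  show "inner x x = 0 \<longleftrightarrow> x = 0"
    by transfer (simp add: ell2_inner_same suminf_eq_zero_iff fun_eq_iff)
qed

end

lemma norm_ell2_eq: "norm x = sqrt (\<Sum>n. (cmod (Rep_ell2 x n))\<^sup>2)"
  unfolding norm_ell2_def by transfer (simp add: ell2_inner_same)

lemma summable_Rep_ell2: "summable (\<lambda>n. (cmod (Rep_ell2 x n))\<^sup>2)"
  using Rep_ell2[of x] by simp

lemma sum_Rep_ell2_le: "(\<Sum>n<N. (cmod (Rep_ell2 x n))\<^sup>2) \<le> (norm x)\<^sup>2"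
  using sum_le_suminf[OF summable_Rep_ell2[of x], of "{..<N}"]
  by (simp add: norm_ell2_eq suminf_nonneg summable_Rep_ell2)

instance ell2 :: complete_space
proof
  fix X :: "nat \<Rightarrow> ell2"
  assume X: "Cauchy X"
  have coord: "cmod (Rep_ell2 x n) \<le> norm x" for x n
  proof -
    have "(cmod (Rep_ell2 x n))\<^sup>2 \<le> (\<Sum>n<Suc n. (cmod (Rep_ell2 x n))\<^sup>2)"
      by (simp add: sum_nonneg)
    also have "\<dots> \<le> (norm x)\<^sup>2" by (rule sum_Rep_ell2_le)
    finally show ?thesis by (rule power2_le_imp_le) simp
  qed
  have "Cauchy (\<lambda>k. Rep_ell2 (X k) n)" for n
  proof (rule metric_CauchyI)
    fix e :: real assume "e > 0"
    then obtain M where M: "\<And>j k. j \<ge> M \<Longrightarrow> k \<ge> M \<Longrightarrow> norm (X j - X k) < e"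
      using metric_CauchyD[OF X] unfolding dist_norm by blast
    have "dist (Rep_ell2 (X j) n) (Rep_ell2 (X k) n) < e" if "j \<ge> M" "k \<ge> M" for j k
      using coord[of "X j - X k" n] M[OF that] by (simp add: dist_norm minus_ell2.rep_eq)
    then show "\<exists>M. \<forall>j\<ge>M. \<forall>k\<ge>M. dist (Rep_ell2 (X j) n) (Rep_ell2 (X k) n) < e" by blast
  qed
  then obtain f where f: "\<And>n. (\<lambda>k. Rep_ell2 (X k) n) \<longlonglongrightarrow> f n"
    unfolding Cauchy_convergent_iff convergent_def by metis
  have bound: "\<exists>M. \<forall>j\<ge>M. \<forall>N. (\<Sum>n<N. (cmod (Rep_ell2 (X j) n - f n))\<^sup>2) \<le> e\<^sup>2" if "e > 0" for e
  proof -
    from that obtain M where M: "\<And>j k. j \<ge> M \<Longrightarrow> k \<ge> M \<Longrightarrow> norm (X j - X k) < e"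
      using metric_CauchyD[OF X] unfolding dist_norm by blast
    have "(\<Sum>n<N. (cmod (Rep_ell2 (X j) n - f n))\<^sup>2) \<le> e\<^sup>2" if j: "j \<ge> M" for j N
    proof (rule LIMSEQ_le_const2)
      show "(\<lambda>k. \<Sum>n<N. (cmod (Rep_ell2 (X j) n - Rep_ell2 (X k) n))\<^sup>2)
          \<longlonglongrightarrow> (\<Sum>n<N. (cmod (Rep_ell2 (X j) n - f n))\<^sup>2)"
        by (intro tendsto_intros f)
      have "(\<Sum>n<N. (cmod (Rep_ell2 (X j) n - Rep_ell2 (X k) n))\<^sup>2) \<le> e\<^sup>2" if k: "k \<ge> M" for k
      proof -
        have "(\<Sum>n<N. (cmod (Rep_ell2 (X j) n - Rep_ell2 (X k) n))\<^sup>2) \<le> (norm (X j - X k))\<^sup>2"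
          using sum_Rep_ell2_le[where N = N and x = "X j - X k"] by (simp add: minus_ell2.rep_eq)
        also have "\<dots> \<le> e\<^sup>2" using M[OF j k] by (intro power_mono) auto
        finally show ?thesis .
      qed
      then show "\<exists>M. \<forall>k\<ge>M. (\<Sum>n<N. (cmod (Rep_ell2 (X j) n - Rep_ell2 (X k) n))\<^sup>2) \<le> e\<^sup>2"
        by blast
    qed
    then show ?thesis by blast
  qed
  have summ: "summable (\<lambda>n. (cmod (Rep_ell2 (X j) n - f n))\<^sup>2)"
    if "\<And>N. (\<Sum>n<N. (cmod (Rep_ell2 (X j) n - f n))\<^sup>2) \<le> b" for j b
    by (rule summableI_nonneg_bounded[OF _ that]) simp
  obtain J where J: "\<And>N. (\<Sum>n<N. (cmod (Rep_ell2 (X J) n - f n))\<^sup>2) \<le> 1\<^sup>2"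
    using bound[of 1] by auto
  have "summable (\<lambda>n. (cmod (f n))\<^sup>2)"
    using ell2_add[OF summable_Rep_ell2[of "X J"] ell2_scale[OF summ[OF J], of "-1"]] by simp
  then have Rep: "Rep_ell2 (Abs_ell2 f) = f" by (simp add: Abs_ell2_inverse)
  have "X \<longlonglongrightarrow> Abs_ell2 f"
  proof (rule metric_LIMSEQ_I)
    fix r :: real assume "r > 0"
    then obtain M where M: "\<And>j N. j \<ge> M \<Longrightarrow> (\<Sum>n<N. (cmod (Rep_ell2 (X j) n - f n))\<^sup>2) \<le> (r/2)\<^sup>2"
      using bound[of "r/2"] by auto
    have "dist (X j) (Abs_ell2 f) < r" if "j \<ge> M" for j
    proof -
      have "(\<Sum>n. (cmod (Rep_ell2 (X j) n - f n))\<^sup>2) \<le> (r/2)\<^sup>2"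
        using M[OF that] by (intro suminf_le_const summ[OF M[OF that]]) auto
      then have "norm (X j - Abs_ell2 f) \<le> sqrt ((r/2)\<^sup>2)"
        unfolding norm_ell2_eq minus_ell2.rep_eq Rep by (rule real_sqrt_le_mono)
      then show ?thesis using \<open>r > 0\<close> by (simp add: dist_norm)
    qed
    then show "\<exists>M. \<forall>j\<ge>M. dist (X j) (Abs_ell2 f) < r" by blast
  qed
  then show "convergent X" by (rule convergentI)
qed

instantiation ell2 :: chilbert_space
begin

lift_definition scaleC_ell2 :: "complex \<Rightarrow> ell2 \<Rightarrow> ell2" is "\<lambda>c f n. c * f n"
  by (rule ell2_scale)

lift_definition cinner_ell2 :: "ell2 \<Rightarrow> ell2 \<Rightarrow> complex" is "\<lambda>f g. \<Sum>n. f n * cnj (g n)" .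

instance
proof
  fix x y z :: ell2 and c d :: complex and r :: real
  show "c *\<^sub>C (x + y) = c *\<^sub>C x + c *\<^sub>C y" by transfer (simp add: algebra_simps)
  show "(c + d) *\<^sub>C x = c *\<^sub>C x + d *\<^sub>C x" by transfer (simp add: algebra_simps)
  show "c *\<^sub>C d *\<^sub>C x = (c * d) *\<^sub>C x" by transfer (simp add: algebra_simps)
  show "r *\<^sub>R x = complex_of_real r *\<^sub>C x" by transfer simp
  show "inner x y = Re (cinner x y)" by transfer simp
  show "cinner x y = cnj (cinner y x)"
  proof transfer
    fix f g :: "nat \<Rightarrow> complex"
    assume f: "summable (\<lambda>n. (cmod (f n))\<^sup>2)" and g: "summable (\<lambda>n. (cmod (g n))\<^sup>2)"
    have "(\<lambda>n. cnj (g n * cnj (f n))) sums cnj (\<Sum>n. g n * cnj (f n))"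
      using summable_sums[OF ell2_mult_cnj[OF g f]] by (simp only: sums_cnj)
    then show "(\<Sum>n. f n * cnj (g n)) = cnj (\<Sum>n. g n * cnj (f n))"
      by (simp add: sums_iff mult.commute)
  qed
  show "cinner (x + y) z = cinner x z + cinner y z"
    by transfer (simp add: distrib_right suminf_add ell2_mult_cnj)
  show "cinner (c *\<^sub>C x) y = c * cinner x y"
    by transfer (simp add: mult.assoc suminf_mult ell2_mult_cnj)
qed

end


section \<open>Operator algebras\<close>

text \<open>The type of \<open>T :: 'h \<Rightarrow>\<^sub>L 'h\<close> only provides real linearity, so \<open>B(H)\<close> is singled out as a
  set. The norm (and hence the topology) of that type is the operator norm.\<close>

definition bounded_operators :: "('h::chilbert_space \<Rightarrow>\<^sub>L 'h) set" where
  "bounded_operators = {T. \<forall>c x. blinfun_apply T (c *\<^sub>C x) = c *\<^sub>C blinfun_apply T x}"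

definition op_scale :: "complex \<Rightarrow> ('h::chilbert_space \<Rightarrow>\<^sub>L 'h) \<Rightarrow> ('h \<Rightarrow>\<^sub>L 'h)" where
  "op_scale c T = Blinfun (\<lambda>x. c *\<^sub>C blinfun_apply T x)"

lemma op_scale_apply [simp]: "blinfun_apply (op_scale c T) x = c *\<^sub>C blinfun_apply T x"
  unfolding op_scale_def
  by (simp add: bounded_linear_Blinfun_apply
      bounded_linear_compose[OF bounded_linear_scaleC blinfun.bounded_linear_right])

definition complex_subspace :: "('h::chilbert_space \<Rightarrow>\<^sub>L 'h) set \<Rightarrow> bool" where
  "complex_subspace V \<longleftrightarrow> 0 \<in> V \<and> (\<forall>x\<in>V. \<forall>y\<in>V. x + y \<in> V) \<and> (\<forall>c. \<forall>x\<in>V. op_scale c x \<in> V)"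

definition operator_algebra :: "('h::chilbert_space \<Rightarrow>\<^sub>L 'h) set \<Rightarrow> bool" where
  "operator_algebra A \<longleftrightarrow>
     A \<subseteq> bounded_operators \<and> complex_subspace A \<and> (\<forall>a\<in>A. \<forall>b\<in>A. a o\<^sub>L b \<in> A) \<and> closed A"

definition commutative_algebra :: "('h::chilbert_space \<Rightarrow>\<^sub>L 'h) set \<Rightarrow> bool" where
  "commutative_algebra A \<longleftrightarrow> (\<forall>a\<in>A. \<forall>b\<in>A. a o\<^sub>L b = b o\<^sub>L a)"

text \<open>A two-sided contractive approximate identity; nets are rendered by proper filters.\<close>

definition approximately_unital :: "('h::chilbert_space \<Rightarrow>\<^sub>L 'h) set \<Rightarrow> bool" where
  "approximately_unital A \<longleftrightarrow>
     (\<exists>F. F \<noteq> bot \<and> (\<forall>\<^sub>F e in F. e \<in> A \<and> norm e \<le> 1) \<and>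
       (\<forall>a\<in>A. ((\<lambda>e. e o\<^sub>L a) \<longlongrightarrow> a) F \<and> ((\<lambda>e. a o\<^sub>L e) \<longlongrightarrow> a) F))"


subsection \<open>Weak compactness\<close>

definition bounded_functionals :: "('h::chilbert_space \<Rightarrow>\<^sub>L 'h) set \<Rightarrow> (('h \<Rightarrow>\<^sub>L 'h) \<Rightarrow> complex) set" where
  "bounded_functionals A =
     {\<phi>. (\<forall>x\<in>A. \<forall>y\<in>A. \<phi> (x + y) = \<phi> x + \<phi> y) \<and>
         (\<forall>c. \<forall>x\<in>A. \<phi> (op_scale c x) = c * \<phi> x) \<and>
         (\<exists>K. \<forall>x\<in>A. cmod (\<phi> x) \<le> K * norm x)}"

definition weak_topology :: "('h::chilbert_space \<Rightarrow>\<^sub>L 'h) set \<Rightarrow> ('h \<Rightarrow>\<^sub>L 'h) topology" where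
  "weak_topology A =
     topology_generated_by {{x \<in> A. \<phi> x \<in> U} | \<phi> U. \<phi> \<in> bounded_functionals A \<and> open U}"

text \<open>For a bounded linear map \<open>T\<close> from \<open>A\<close> to \<open>A\<close>: the image of the closed unit ball is
  relatively weakly compact.\<close>

definition weakly_compact_operator ::
  "('h::chilbert_space \<Rightarrow>\<^sub>L 'h) set \<Rightarrow> (('h \<Rightarrow>\<^sub>L 'h) \<Rightarrow> ('h \<Rightarrow>\<^sub>L 'h)) \<Rightarrow> bool" where
  "weakly_compact_operator A T \<longleftrightarrow>
     compactin (weak_topology A) (weak_topology A closure_of (T ` {x \<in> A. norm x \<le> 1}))"

definition weakly_compact_algebra :: "('h::chilbert_space \<Rightarrow>\<^sub>L 'h) set \<Rightarrow> bool" where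
  "weakly_compact_algebra A \<longleftrightarrow> (\<forall>a\<in>A. weakly_compact_operator A (\<lambda>x. a o\<^sub>L x o\<^sub>L a))"


subsection \<open>Semisimplicity\<close>

definition left_ideal :: "('h::chilbert_space \<Rightarrow>\<^sub>L 'h) set \<Rightarrow> ('h \<Rightarrow>\<^sub>L 'h) set \<Rightarrow> bool" where
  "left_ideal A I \<longleftrightarrow> I \<subseteq> A \<and> complex_subspace I \<and> (\<forall>a\<in>A. \<forall>x\<in>I. a o\<^sub>L x \<in> I)"

definition maximal_modular_left_ideal :: "('h::chilbert_space \<Rightarrow>\<^sub>L 'h) set \<Rightarrow> ('h \<Rightarrow>\<^sub>L 'h) set \<Rightarrow> bool" where
  "maximal_modular_left_ideal A I \<longleftrightarrow>
     left_ideal A I \<and> I \<noteq> A \<and> (\<exists>u\<in>A. \<forall>a\<in>A. a - (a o\<^sub>L u) \<in> I) \<and>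
     (\<forall>J. left_ideal A J \<and> I \<subseteq> J \<and> J \<noteq> A \<longrightarrow> J = I)"

definition jacobson_radical :: "('h::chilbert_space \<Rightarrow>\<^sub>L 'h) set \<Rightarrow> ('h \<Rightarrow>\<^sub>L 'h) set" where
  "jacobson_radical A = {a \<in> A. \<forall>I. maximal_modular_left_ideal A I \<longrightarrow> a \<in> I}"

definition semisimple_algebra :: "('h::chilbert_space \<Rightarrow>\<^sub>L 'h) set \<Rightarrow> bool" where
  "semisimple_algebra A \<longleftrightarrow> jacobson_radical A = {0}"


subsection \<open>Spectra\<close>

text \<open>Characters are taken in \<^const>\<open>extensional\<close> form, so that distinct members of this set
  are distinct as functionals on \<open>A\<close>. Their boundedness is automatic.\<close>

definition characters :: "('h::chilbert_space \<Rightarrow>\<^sub>L 'h) set \<Rightarrow> (('h \<Rightarrow>\<^sub>L 'h) \<Rightarrow> complex) set" where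
  "characters A =
     {h \<in> extensional A.
        (\<forall>x\<in>A. \<forall>y\<in>A. h (x + y) = h x + h y) \<and>
        (\<forall>c. \<forall>x\<in>A. h (op_scale c x) = c * h x) \<and>
        (\<forall>x\<in>A. \<forall>y\<in>A. h (x o\<^sub>L y) = h x * h y) \<and>
        (\<exists>x\<in>A. h x \<noteq> 0)}"

text \<open>The maximal ideal space of a commutative \<open>A\<close>: the characters with the topology of
  pointwise convergence on \<open>A\<close> (the weak-* topology).\<close>

definition maximal_ideal_space :: "('h::chilbert_space \<Rightarrow>\<^sub>L 'h) set \<Rightarrow> (('h \<Rightarrow>\<^sub>L 'h) \<Rightarrow> complex) topology" where
  "maximal_ideal_space A = subtopology (product_topology (\<lambda>_. euclidean) A) (characters A)"

definition scattered_space :: "'a topology \<Rightarrow> bool" where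
  "scattered_space X \<longleftrightarrow>
     (\<forall>S. S \<subseteq> topspace X \<and> S \<noteq> {} \<longrightarrow> (\<exists>x\<in>S. openin (subtopology X S) {x}))"

definition is_unit_of :: "('h::chilbert_space \<Rightarrow>\<^sub>L 'h) set \<Rightarrow> ('h \<Rightarrow>\<^sub>L 'h) \<Rightarrow> bool" where
  "is_unit_of A e \<longleftrightarrow> e \<in> A \<and> (\<forall>a\<in>A. e o\<^sub>L a = a \<and> a o\<^sub>L e = a)"

definition unital_spectrum ::
  "('h::chilbert_space \<Rightarrow>\<^sub>L 'h) set \<Rightarrow> ('h \<Rightarrow>\<^sub>L 'h) \<Rightarrow> ('h \<Rightarrow>\<^sub>L 'h) \<Rightarrow> complex set" where
  "unital_spectrum A e a =
     {z. \<not> (\<exists>b\<in>A. (op_scale z e - a) o\<^sub>L b = e \<and> b o\<^sub>L (op_scale z e - a) = e)}"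

text \<open>If \<open>A\<close> has an identity (which need not be the identity operator), the spectrum is taken
  in \<open>A\<close>. Otherwise the identity operator is not in \<open>A\<close>, so the span of \<open>A\<close> and the identity
  operator is the unitization of \<open>A\<close>, and the spectrum is taken there.\<close>

definition spectrum_in :: "('h::chilbert_space \<Rightarrow>\<^sub>L 'h) set \<Rightarrow> ('h \<Rightarrow>\<^sub>L 'h) \<Rightarrow> complex set" where
  "spectrum_in A a =
     (if \<exists>e. is_unit_of A e then unital_spectrum A (THE e. is_unit_of A e) a
      else unital_spectrum {b + op_scale c id_blinfun | b c. b \<in> A} id_blinfun a)"

end

(* A square-summable sequence x encodes the power series with coefficients x_n / (n + 1). Since
   (n + 1) / ((i + 1) (n - i + 1)) <= 1 / (i + 1) + 1 / (n - i + 1) is square-summable over i <= n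
   with a bound independent of n, Cauchy-Schwarz makes the product of two such series again of this
   form, with norm at most 3 |x| |y|. So these series form a unital Banach algebra, and it embeds
   bicontinuously into B(ell2) by multiplication. The image is linearly homeomorphic to a Hilbert
   space, hence reflexive, so every bounded operator on it is weakly compact. Evaluations at the
   points of the open unit disc are characters; they separate elements, and they put the whole disc
   into the maximal ideal space and into the spectrum of multiplication by the variable. *)

theory Submission
  imports Defs
begin


section \<open>Coordinates and finite truncations in \<open>ell2\<close>\<close>

lemma norm_ell2_squared: "(norm x)\<^sup>2 = (\<Sum>n. (cmod (Rep_ell2 x n))\<^sup>2)"
  by (simp add: norm_ell2_eq suminf_nonneg summable_Rep_ell2)

lemma norm_Rep_ell2_le: "cmod (Rep_ell2 x n) \<le> norm x"
proof (rule power2_le_imp_le)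
  have "(cmod (Rep_ell2 x n))\<^sup>2 \<le> (\<Sum>k<Suc n. (cmod (Rep_ell2 x k))\<^sup>2)"
    by (simp add: sum_nonneg)
  also have "\<dots> \<le> (norm x)\<^sup>2" by (rule sum_Rep_ell2_le)
  finally show "(cmod (Rep_ell2 x n))\<^sup>2 \<le> (norm x)\<^sup>2" .
qed simp

lemma ell2_eqI: "(\<And>n. Rep_ell2 x n = Rep_ell2 y n) \<Longrightarrow> x = y"
  by (metis Rep_ell2_inject ext)

lift_definition basis_ell2 :: "nat \<Rightarrow> ell2" is "\<lambda>k n. if n = k then 1 else 0"
  subgoal for k by (rule summable_finite[of "{k}"]) auto
  done

lift_definition truncate_ell2 :: "nat \<Rightarrow> ell2 \<Rightarrow> ell2" is "\<lambda>N f n. if n < N then f n else 0"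
  subgoal for N f by (rule summable_finite[of "{..<N}"]) auto
  done

lemma norm_truncate_ell2: "(norm (truncate_ell2 N x))\<^sup>2 = (\<Sum>n<N. (cmod (Rep_ell2 x n))\<^sup>2)"
  unfolding norm_ell2_squared truncate_ell2.rep_eq
  by (subst suminf_finite[of "{..<N}"]) auto

lemma truncate_ell2_eq_sum: "truncate_ell2 N x = (\<Sum>n<N. Rep_ell2 x n *\<^sub>C basis_ell2 n)"
proof (induction N)
  case 0
  show ?case by (rule ell2_eqI) (simp add: truncate_ell2.rep_eq zero_ell2.rep_eq)
next
  case (Suc N)
  have "truncate_ell2 (Suc N) x = truncate_ell2 N x + Rep_ell2 x N *\<^sub>C basis_ell2 N"
    by (rule ell2_eqI)
      (auto simp: truncate_ell2.rep_eq plus_ell2.rep_eq scaleC_ell2.rep_eq basis_ell2.rep_eq less_Suc_eq)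
  then show ?case by (simp add: Suc.IH)
qed

text \<open>By orthogonality the squared error is the squared norm minus the partial sum of the
  squared coordinates, and these partial sums converge to the squared norm.\<close>

lemma truncate_ell2_LIMSEQ: "(\<lambda>N. truncate_ell2 N x) \<longlonglongrightarrow> x"
proof -
  have eq: "(norm (truncate_ell2 N x - x))\<^sup>2 = (norm x)\<^sup>2 - (norm (truncate_ell2 N x))\<^sup>2" for N
  proof -
    have "(norm (truncate_ell2 N x - x))\<^sup>2
        = (\<Sum>n. (cmod (Rep_ell2 x n))\<^sup>2 - (cmod (Rep_ell2 (truncate_ell2 N x) n))\<^sup>2)"
      unfolding norm_ell2_squared
      by (intro arg_cong[where f = suminf] ext) (simp add: truncate_ell2.rep_eq minus_ell2.rep_eq)
    then show ?thesis
      by (simp add: norm_ell2_squared suminf_diff summable_Rep_ell2)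
  qed
  have "(\<lambda>N. (norm (truncate_ell2 N x))\<^sup>2) \<longlonglongrightarrow> (norm x)\<^sup>2"
    unfolding norm_truncate_ell2 norm_ell2_squared[of x] by (rule summable_LIMSEQ[OF summable_Rep_ell2])
  then have "(\<lambda>N. (norm x)\<^sup>2 - (norm (truncate_ell2 N x))\<^sup>2) \<longlonglongrightarrow> (norm x)\<^sup>2 - (norm x)\<^sup>2"
    by (rule tendsto_diff[OF tendsto_const])
  then have "(\<lambda>N. (norm (truncate_ell2 N x - x))\<^sup>2) \<longlonglongrightarrow> 0"
    by (simp only: eq diff_self)
  then have "(\<lambda>N. sqrt ((norm (truncate_ell2 N x - x))\<^sup>2)) \<longlonglongrightarrow> sqrt 0"
    by (rule tendsto_real_sqrt)
  then have "(\<lambda>N. norm (truncate_ell2 N x - x)) \<longlonglongrightarrow> 0" by simp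
  then show ?thesis using LIM_zero_iff tendsto_norm_zero_iff by blast
qed

text \<open>The real Cauchy-Schwarz inequality bounds the real part and, after multiplying
  \<open>x\<close> by -i, the imaginary part. Adding the two costs a factor 2, harmless because only
  continuity estimates use it.\<close>

lemma norm_cinner_le: "cmod (cinner x y) \<le> 2 * norm x * norm (y :: 'a::chilbert_space)"
proof -
  have "\<bar>Re (cinner x y)\<bar> \<le> norm x * norm y"
    using Cauchy_Schwarz_ineq2[of x y] by (simp add: inner_eq_Re_cinner)
  moreover have "\<bar>Im (cinner x y)\<bar> \<le> norm x * norm y"
    using Cauchy_Schwarz_ineq2[of "- \<i> *\<^sub>C x" y]
    by (simp add: inner_eq_Re_cinner cinner_scaleC_left norm_scaleC)
  ultimately show ?thesis using cmod_le[of "cinner x y"] by simp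
qed

section \<open>Weak compactness of balls of square-summable sequences\<close>

text \<open>The values of the functional on the basis turn out to be square-summable, so their
  conjugates form a vector. Both sides agree on truncations, and continuity extends the equality to
  all of \<open>ell2\<close>.\<close>

lemma riesz_ell2:
  fixes \<psi> :: "ell2 \<Rightarrow> complex"
  assumes add: "\<And>x y. \<psi> (x + y) = \<psi> x + \<psi> y" and scale: "\<And>c x. \<psi> (c *\<^sub>C x) = c * \<psi> x"
    and bound: "\<And>x. cmod (\<psi> x) \<le> K * norm x"
  obtains y where "\<And>x. \<psi> x = cinner x y"
proof -
  define c where "c n = \<psi> (basis_ell2 n)" for n
  have zero: "\<psi> 0 = 0" using add[of 0 0] by simp
  have sum: "\<psi> (\<Sum>n<N. g n *\<^sub>C basis_ell2 n) = (\<Sum>n<N. g n * c n)" for g and N :: nat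
    by (induction N) (simp_all add: zero add scale c_def)
  have trunc: "\<psi> (truncate_ell2 N x) = (\<Sum>n<N. Rep_ell2 x n * c n)" for N x
    by (simp add: truncate_ell2_eq_sum sum)
  have "(\<Sum>n<N. (cmod (c n))\<^sup>2) \<le> K\<^sup>2" for N
  proof -
    \<comment> \<open>On this test vector the functional takes the value \<open>s\<^sup>2\<close>
      with \<open>s = norm z\<close>, so the bound gives \<open>s \<le> \<bar>K\<bar>\<close>
      uniformly in \<open>N\<close>. The sign of \<open>K\<close> is unknown, hence the absolute
      value.\<close>
    define z where "z = Abs_ell2 (\<lambda>n. if n < N then cnj (c n) else 0)"
    have Rep: "Rep_ell2 z = (\<lambda>n. if n < N then cnj (c n) else 0)"
      unfolding z_def by (rule Abs_ell2_inverse) (auto intro!: summable_finite[of "{..<N}"] split: if_splits)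
    define s where "s = norm z"
    have tz: "truncate_ell2 N z = z"
      by (rule ell2_eqI) (simp add: truncate_ell2.rep_eq Rep)
    have s2: "s\<^sup>2 = (\<Sum>n<N. (cmod (c n))\<^sup>2)"
      using norm_truncate_ell2[of N z] by (simp add: s_def tz Rep)
    have "\<psi> z = (\<Sum>n<N. cnj (c n) * c n)"
      using trunc[of N z] by (simp add: tz Rep)
    also have "\<dots> = complex_of_real (s\<^sup>2)"
      unfolding s2 of_real_sum by (rule sum.cong) (simp_all add: complex_norm_square mult.commute del: of_real_power)
    finally have "s\<^sup>2 \<le> K * s"
      using bound[of z] by (simp add: s_def norm_power)
    moreover have "0 \<le> s" by (simp add: s_def)
    ultimately have "s \<le> \<bar>K\<bar>"
      by (cases "s = 0") (auto simp: power2_eq_square)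
    then have "s\<^sup>2 \<le> K\<^sup>2" using \<open>0 \<le> s\<close> by (simp flip: abs_le_square_iff)
    then show ?thesis by (simp add: s2)
  qed
  then have summ: "summable (\<lambda>n. (cmod (cnj (c n)))\<^sup>2)"
    by (intro summableI_nonneg_bounded[where x = "K\<^sup>2"]) simp_all
  define y where "y = Abs_ell2 (\<lambda>n. cnj (c n))"
  have Rep_y: "Rep_ell2 y = (\<lambda>n. cnj (c n))"
    unfolding y_def using summ by (intro Abs_ell2_inverse) simp
  have "\<psi> x = cinner x y" for x
  proof (rule LIMSEQ_unique)
    interpret bounded_linear \<psi>
      by (rule bounded_linear_intro[where K = K])
        (simp_all add: add scaleR_eq_scaleC scale bound mult.commute scaleR_conv_of_real)
    show "(\<lambda>N. \<psi> (truncate_ell2 N x)) \<longlonglongrightarrow> \<psi> x"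
      by (rule tendsto[OF truncate_ell2_LIMSEQ])
    have "summable (\<lambda>n. Rep_ell2 x n * cnj (Rep_ell2 y n))"
      by (intro ell2_mult_cnj summable_Rep_ell2)
    then show "(\<lambda>N. \<psi> (truncate_ell2 N x)) \<longlonglongrightarrow> cinner x y"
      unfolding trunc cinner_ell2.rep_eq using summable_LIMSEQ by (simp add: Rep_y)
  qed
  then show thesis by (rule that)
qed

text \<open>Bounding partial sums instead of the infinite sum makes each condition depend on
  finitely many coordinates, so the set is closed for pointwise convergence; square-summability then
  follows.\<close>

definition ball_sequences :: "real \<Rightarrow> (nat \<Rightarrow> complex) set" where
  "ball_sequences R = {f. \<forall>N. (\<Sum>n<N. (cmod (f n))\<^sup>2) \<le> R\<^sup>2}"

text \<open>Tychonoff: the set is closed in a product of closed discs of radius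
  \<open>\<bar>R\<bar>\<close>.\<close>

lemma compact_ball_sequences: "compact (ball_sequences R)"
proof -
  have "compactin (product_topology (\<lambda>_. euclidean) UNIV) (PiE UNIV (\<lambda>_::nat. cball (0::complex) \<bar>R\<bar>))"
    by (simp add: compactin_PiE)
  then have "compact (PiE UNIV (\<lambda>_::nat. cball (0::complex) \<bar>R\<bar>))"
    by (simp add: euclidean_product_topology)
  moreover have "closed (ball_sequences R)"
    unfolding ball_sequences_def
    by (intro closed_Collect_all closed_Collect_le continuous_intros continuous_on_product_coordinates)
  moreover have "ball_sequences R \<subseteq> PiE UNIV (\<lambda>_. cball 0 \<bar>R\<bar>)"
  proof
    fix f assume f: "f \<in> ball_sequences R"
    have "cmod (f n) \<le> \<bar>R\<bar>" for n
    proof -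
      have "(cmod (f n))\<^sup>2 \<le> (\<Sum>k<Suc n. (cmod (f k))\<^sup>2)" by (simp add: sum_nonneg)
      also have "\<dots> \<le> R\<^sup>2" using f unfolding ball_sequences_def by blast
      finally show ?thesis using abs_le_square_iff[of "cmod (f n)" R] by simp
    qed
    then show "f \<in> PiE UNIV (\<lambda>_. cball 0 \<bar>R\<bar>)" by auto
  qed
  ultimately show ?thesis by (metis compact_Int_closed inf.absorb_iff2)
qed

lemma Rep_Abs_ball_sequences:
  assumes "f \<in> ball_sequences R"
  shows "Rep_ell2 (Abs_ell2 f) = f" and "norm (Abs_ell2 f) \<le> \<bar>R\<bar>"
proof -
  have le: "(\<Sum>n<N. (cmod (f n))\<^sup>2) \<le> R\<^sup>2" for N
    using assms unfolding ball_sequences_def by blast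
  then have s: "summable (\<lambda>n. (cmod (f n))\<^sup>2)"
    by (intro summableI_nonneg_bounded[where x = "R\<^sup>2"]) simp_all
  then show Rep: "Rep_ell2 (Abs_ell2 f) = f" by (simp add: Abs_ell2_inverse)
  have "(norm (Abs_ell2 f))\<^sup>2 \<le> R\<^sup>2"
    unfolding norm_ell2_squared Rep by (rule suminf_le_const[OF s le])
  then show "norm (Abs_ell2 f) \<le> \<bar>R\<bar>" using abs_le_square_iff[of "norm (Abs_ell2 f)" R] by simp
qed

lemma image_ball_sequences: "Abs_ell2 ` ball_sequences R = cball 0 \<bar>R\<bar>"
proof
  show "Abs_ell2 ` ball_sequences R \<subseteq> cball 0 \<bar>R\<bar>"
    using Rep_Abs_ball_sequences(2) by auto
  show "cball 0 \<bar>R\<bar> \<subseteq> Abs_ell2 ` ball_sequences R"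
  proof
    fix x :: ell2 assume "x \<in> cball 0 \<bar>R\<bar>"
    then have "(norm x)\<^sup>2 \<le> R\<^sup>2" using abs_le_square_iff[of "norm x" R] by simp
    then have "Rep_ell2 x \<in> ball_sequences R"
      unfolding ball_sequences_def using sum_Rep_ell2_le order_trans by blast
    then show "x \<in> Abs_ell2 ` ball_sequences R"
      by (intro image_eqI[of _ _ "Rep_ell2 x"]) (simp_all add: Rep_ell2_inverse)
  qed
qed

text \<open>On a norm-bounded set, pointwise convergence is as strong as weak convergence:
  truncating \<open>y\<close> gives finite sums in the coordinates, and the error is small uniformly
  in \<open>f\<close> because \<open>norm (Abs_ell2 f)\<close> is at most
  \<open>\<bar>R\<bar>\<close>.\<close>

lemma continuous_on_cinner_ball_sequences:
  "continuous_on (ball_sequences R) (\<lambda>f. cinner (Abs_ell2 f) y)"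
proof (rule uniform_limit_theorem[where F = sequentially])
  let ?S = "\<lambda>N f. \<Sum>n<N. f n * cnj (Rep_ell2 y n)"
  show "\<forall>\<^sub>F N in sequentially. continuous_on (ball_sequences R) (?S N)"
  proof (intro always_eventually allI continuous_intros)
    show "continuous_on (ball_sequences R) (\<lambda>f. f n)" for n
      by (rule continuous_on_subset[OF continuous_on_product_coordinates]) simp
  qed
  have dist_le: "dist (?S N f) (cinner (Abs_ell2 f) y) \<le> 2 * \<bar>R\<bar> * norm (truncate_ell2 N y - y)"
    if f: "f \<in> ball_sequences R" for f N
  proof -
    let ?x = "Abs_ell2 f"
    have "cinner ?x (truncate_ell2 N y) = ?S N f"
      unfolding cinner_ell2.rep_eq truncate_ell2.rep_eq Rep_Abs_ball_sequences(1)[OF f]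
      by (subst suminf_finite[of "{..<N}"]) auto
    moreover have "cinner ?x (truncate_ell2 N y - y) = cinner ?x (truncate_ell2 N y) - cinner ?x y"
    proof -
      have "summable (\<lambda>n. Rep_ell2 ?x n * cnj (Rep_ell2 z n))" for z
        by (intro ell2_mult_cnj summable_Rep_ell2)
      from suminf_diff[OF this[of "truncate_ell2 N y"] this[of y]]
      show ?thesis unfolding cinner_ell2.rep_eq minus_ell2.rep_eq by (simp add: algebra_simps)
    qed
    ultimately have "dist (?S N f) (cinner ?x y) = cmod (cinner ?x (truncate_ell2 N y - y))"
      by (simp add: dist_norm)
    also have "\<dots> \<le> 2 * norm ?x * norm (truncate_ell2 N y - y)" by (rule norm_cinner_le)
    also have "\<dots> \<le> 2 * \<bar>R\<bar> * norm (truncate_ell2 N y - y)"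
      using Rep_Abs_ball_sequences(2)[OF f] by (intro mult_right_mono) auto
    finally show ?thesis .
  qed
  show "uniform_limit (ball_sequences R) ?S (\<lambda>f. cinner (Abs_ell2 f) y) sequentially"
  proof (rule uniform_limitI)
    fix e :: real assume "e > 0"
    have "(\<lambda>N. 2 * \<bar>R\<bar> * norm (truncate_ell2 N y - y)) \<longlonglongrightarrow> 2 * \<bar>R\<bar> * norm (y - y)"
      by (intro tendsto_intros truncate_ell2_LIMSEQ)
    then have "\<forall>\<^sub>F N in sequentially. 2 * \<bar>R\<bar> * norm (truncate_ell2 N y - y) < e"
      using \<open>e > 0\<close> by (intro order_tendstoD(2)[where a = e]) auto
    then show "\<forall>\<^sub>F N in sequentially. \<forall>f\<in>ball_sequences R. dist (?S N f) (cinner (Abs_ell2 f) y) < e"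
      by eventually_elim (use dist_le in \<open>fastforce intro: le_less_trans\<close>)
  qed
qed simp

section \<open>Multiplication of weighted power series\<close>

text \<open>The sharper bound with \<open>1 / real (Suc n)\<close> makes the induction go through by
  telescoping; afterwards only the bound 2 matters.\<close>

lemma sum_inverse_squares_le: "(\<Sum>k\<le>n. 1 / (real (Suc k))\<^sup>2) \<le> 2 - 1 / real (Suc n)"
proof (induction n)
  case (Suc n)
  have "1 / (real (Suc (Suc n)))\<^sup>2 \<le> 1 / (real (Suc n) * real (Suc (Suc n)))"
    by (simp add: power2_eq_square frac_le)
  also have "\<dots> = 1 / real (Suc n) - 1 / real (Suc (Suc n))" by (simp add: field_simps)
  finally show ?case using Suc.IH by simp
qed simp

text \<open>The weight is at most the sum of the two reciprocals, since \<open>Suc n\<close> is at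
  most the sum of the two factors. Squaring gives two sums that coincide after reversing the index
  and contribute at most 4 each; 8 is rounded up to the square 9.\<close>

lemma sum_weights_le:
  "(\<Sum>i\<le>n. (real (Suc n) / (real (Suc i) * real (Suc (n - i))))\<^sup>2) \<le> 9"
proof -
  have "(real (Suc n) / (real (Suc i) * real (Suc (n - i))))\<^sup>2
      \<le> 2 * (1 / (real (Suc i))\<^sup>2) + 2 * (1 / (real (Suc (n - i)))\<^sup>2)" if "i \<le> n" for i
  proof -
    define a b where "a = real (Suc i)" and "b = real (Suc (n - i))"
    have ab: "a > 0" "b > 0" "real (Suc n) \<le> a + b" using that by (auto simp: a_def b_def)
    have "real (Suc n) / (a * b) \<le> (a + b) / (a * b)" using ab by (intro divide_right_mono) auto
    also have "\<dots> = 1 / a + 1 / b" using ab by (simp add: field_simps)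
    finally have "(real (Suc n) / (a * b))\<^sup>2 \<le> (1 / a + 1 / b)\<^sup>2"
      using ab by (intro power_mono) auto
    also have "\<dots> \<le> 2 * (1 / a)\<^sup>2 + 2 * (1 / b)\<^sup>2"
      using sum_squares_bound[of "1 / a" "1 / b"] by (simp add: power2_sum)
    finally show ?thesis by (simp add: a_def b_def power_divide)
  qed
  then have "(\<Sum>i\<le>n. (real (Suc n) / (real (Suc i) * real (Suc (n - i))))\<^sup>2)
      \<le> (\<Sum>i\<le>n. 2 * (1 / (real (Suc i))\<^sup>2) + 2 * (1 / (real (Suc (n - i)))\<^sup>2))"
    by (intro sum_mono) simp
  also have "\<dots> = 2 * (\<Sum>i\<le>n. 1 / (real (Suc i))\<^sup>2) + 2 * (\<Sum>i\<le>n. 1 / (real (Suc (n - i)))\<^sup>2)"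
    by (simp only: sum.distrib sum_distrib_left)
  also have "(\<Sum>i\<le>n. 1 / (real (Suc (n - i)))\<^sup>2) = (\<Sum>i\<le>n. 1 / (real (Suc i))\<^sup>2)"
    by (rule sum.reindex_bij_witness[of _ "\<lambda>i. n - i" "\<lambda>i. n - i"]) auto
  also have "2 * (\<Sum>i\<le>n. 1 / (real (Suc i))\<^sup>2) + 2 * (\<Sum>i\<le>n. 1 / (real (Suc i))\<^sup>2) \<le> 9"
  proof -
    have "0 \<le> 1 / real (Suc n)" by simp
    then show ?thesis using sum_inverse_squares_le[of n] by linarith
  qed
  finally show ?thesis .
qed

definition series :: "ell2 \<Rightarrow> complex fps" where
  "series x = Abs_fps (\<lambda>n. Rep_ell2 x n / of_nat (Suc n))"

text \<open>Injectivity reduces the later algebraic identities for \<open>ell2_conv\<close> and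
  \<open>mult_op\<close> to identities in the commutative ring of formal power series.\<close>

lemma series_eq_iff: "series x = series y \<longleftrightarrow> x = y"
proof
  assume *: "series x = series y"
  have "Rep_ell2 x n / of_nat (Suc n) = Rep_ell2 y n / of_nat (Suc n)" for n
    using arg_cong[OF *, of "\<lambda>f. fps_nth f n"] by (simp add: series_def)
  then show "x = y" by (intro ell2_eqI) (simp del: of_nat_Suc)
qed simp

lemma series_add: "series (x + y) = series x + series y"
  by (rule fps_ext) (simp add: series_def plus_ell2.rep_eq add_divide_distrib)

lemma series_scaleC: "series (c *\<^sub>C x) = fps_const c * series x"
  by (rule fps_ext) (simp add: series_def scaleC_ell2.rep_eq)

lemma series_0: "series 0 = 0"
  by (rule fps_ext) (simp add: series_def zero_ell2.rep_eq)

lemma series_basis_0: "series (basis_ell2 0) = 1"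
  by (rule fps_ext) (simp add: series_def basis_ell2.rep_eq)

text \<open>The factor 2 cancels the weight 1/2 carried by the coefficient of index 1.\<close>

lemma series_eq_fps_X: "series (2 *\<^sub>C basis_ell2 1) = fps_X"
  by (rule fps_ext) (simp add: series_def basis_ell2.rep_eq scaleC_ell2.rep_eq fps_X_def)

text \<open>Cauchy-Schwarz separates the coordinates from the weights, and
  \<open>sum_weights_le\<close> bounds the weights independently of \<open>n\<close>. What remains
  is a Cauchy product of two summable sequences, so it can be summed over \<open>n\<close>.\<close>

lemma weighted_Cauchy_product_le:
  "(cmod (of_nat (Suc n) * fps_nth (series x * series y) n))\<^sup>2
    \<le> 9 * (\<Sum>i\<le>n. (cmod (Rep_ell2 x i))\<^sup>2 * (cmod (Rep_ell2 y (n - i)))\<^sup>2)"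
proof -
  let ?w = "\<lambda>i. real (Suc n) / (real (Suc i) * real (Suc (n - i)))"
  let ?p = "\<lambda>i. cmod (Rep_ell2 x i) * cmod (Rep_ell2 y (n - i))"
  have "cmod (of_nat (Suc n) * fps_nth (series x * series y) n)
      = cmod (\<Sum>i\<le>n. of_nat (Suc n) * (Rep_ell2 x i / of_nat (Suc i)
          * (Rep_ell2 y (n - i) / of_nat (Suc (n - i)))))"
    by (simp only: fps_mult_nth series_def fps_nth_Abs_fps sum_distrib_left atLeast0AtMost)
  also have "\<dots> \<le> (\<Sum>i\<le>n. cmod (of_nat (Suc n) * (Rep_ell2 x i / of_nat (Suc i)
          * (Rep_ell2 y (n - i) / of_nat (Suc (n - i))))))"
    by (rule norm_sum)
  also have "\<dots> = (\<Sum>i\<le>n. ?p i * ?w i)"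
    by (rule sum.cong) (simp_all add: norm_mult norm_divide norm_of_nat del: of_nat_Suc)
  finally have "(cmod (of_nat (Suc n) * fps_nth (series x * series y) n))\<^sup>2 \<le> (\<Sum>i\<le>n. ?p i * ?w i)\<^sup>2"
    by (intro power_mono) auto
  also have "\<dots> \<le> (\<Sum>i\<le>n. (?p i)\<^sup>2) * (\<Sum>i\<le>n. (?w i)\<^sup>2)" by (rule Cauchy_Schwarz_ineq_sum)
  also have "\<dots> \<le> (\<Sum>i\<le>n. (?p i)\<^sup>2) * 9"
    by (intro mult_left_mono sum_weights_le sum_nonneg) simp
  finally show ?thesis by (simp add: power_mult_distrib mult.commute)
qed

lemma sums_Cauchy_product_ell2:
  "(\<lambda>n. 9 * (\<Sum>i\<le>n. (cmod (Rep_ell2 x i))\<^sup>2 * (cmod (Rep_ell2 y (n - i)))\<^sup>2))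
    sums (9 * ((norm x)\<^sup>2 * (norm y)\<^sup>2))"
  unfolding norm_ell2_squared
  by (intro sums_mult Cauchy_product_sums) (simp_all add: summable_Rep_ell2)

text \<open>The factor \<open>of_nat (Suc n)\<close> undoes the weight built into
  \<open>series\<close>, so that this encodes the product of power series. It is written out on raw
  sequences because it is lifted from them.\<close>

lift_definition ell2_conv :: "ell2 \<Rightarrow> ell2 \<Rightarrow> ell2" is
  "\<lambda>f g n. of_nat (Suc n) * fps_nth (Abs_fps (\<lambda>n. f n / of_nat (Suc n)) * Abs_fps (\<lambda>n. g n / of_nat (Suc n))) n"
proof -
  fix f g :: "nat \<Rightarrow> complex"
  assume f: "summable (\<lambda>n. (cmod (f n))\<^sup>2)" and g: "summable (\<lambda>n. (cmod (g n))\<^sup>2)"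
  from f g have "Rep_ell2 (Abs_ell2 f) = f" "Rep_ell2 (Abs_ell2 g) = g"
    by (simp_all add: Abs_ell2_inverse)
  moreover have *: "summable (\<lambda>n. (cmod (of_nat (Suc n) * fps_nth (series x * series y) n))\<^sup>2)" for x y
    by (rule summable_comparison_test'[OF sums_summable[OF sums_Cauchy_product_ell2[of x y]]])
      (simp only: real_norm_def abs_power2 weighted_Cauchy_product_le)
  ultimately show "summable (\<lambda>n. (cmod (of_nat (Suc n) * fps_nth (Abs_fps (\<lambda>n. f n / of_nat (Suc n))
      * Abs_fps (\<lambda>n. g n / of_nat (Suc n))) n))\<^sup>2)"
    using *[of "Abs_ell2 f" "Abs_ell2 g"] by (simp only: series_def)
qed

lemma Rep_ell2_conv: "Rep_ell2 (ell2_conv x y) n = of_nat (Suc n) * fps_nth (series x * series y) n"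
  unfolding ell2_conv.rep_eq series_def ..

lemma series_ell2_conv: "series (ell2_conv x y) = series x * series y"
  by (rule fps_ext) (simp add: series_def[of "ell2_conv x y"] Rep_ell2_conv del: of_nat_Suc)

lemma norm_ell2_conv_le: "norm (ell2_conv x y) \<le> 3 * norm x * norm y"
proof (rule power2_le_imp_le)
  have "(norm (ell2_conv x y))\<^sup>2
      \<le> (\<Sum>n. 9 * (\<Sum>i\<le>n. (cmod (Rep_ell2 x i))\<^sup>2 * (cmod (Rep_ell2 y (n - i)))\<^sup>2))"
    unfolding norm_ell2_squared[of "ell2_conv x y"]
    by (intro suminf_le sums_summable[OF sums_Cauchy_product_ell2] summable_Rep_ell2)
      (simp only: Rep_ell2_conv weighted_Cauchy_product_le)
  also have "\<dots> = 9 * ((norm x)\<^sup>2 * (norm y)\<^sup>2)"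
    by (rule sums_unique[OF sums_Cauchy_product_ell2, symmetric])
  finally show "(norm (ell2_conv x y))\<^sup>2 \<le> (3 * norm x * norm y)\<^sup>2"
    by (simp add: power_mult_distrib)
qed simp

definition mult_op :: "ell2 \<Rightarrow> (ell2 \<Rightarrow>\<^sub>L ell2)" where
  "mult_op x = Blinfun (ell2_conv x)"

lemma mult_op_apply: "blinfun_apply (mult_op x) y = ell2_conv x y"
proof -
  have "norm (ell2_conv x y) \<le> norm y * (3 * norm x)" for y
    using norm_ell2_conv_le[of x y] by (simp add: mult_ac)
  then have "bounded_linear (ell2_conv x)"
    by (intro bounded_linear_intro[where K = "3 * norm x"])
      (simp_all add: series_eq_iff[symmetric] series_ell2_conv series_add series_scaleC
        scaleR_eq_scaleC algebra_simps)
  then show ?thesis by (simp add: mult_op_def bounded_linear_Blinfun_apply)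
qed

text \<open>The basis vector of index 0 encodes the constant series 1. Applying an operator to it is
  therefore a left inverse of \<open>mult_op\<close>, by which elements are recovered
  throughout.\<close>

lemma mult_op_basis_0 [simp]: "blinfun_apply (mult_op x) (basis_ell2 0) = x"
  by (simp add: mult_op_apply series_eq_iff[symmetric] series_ell2_conv series_basis_0)

lemma mult_op_add: "mult_op (x + y) = mult_op x + mult_op y"
  by (rule blinfun_eqI)
    (simp add: mult_op_apply blinfun.add_left series_eq_iff[symmetric] series_ell2_conv series_add algebra_simps)

lemma mult_op_scaleC: "mult_op (c *\<^sub>C x) = op_scale c (mult_op x)"
  by (rule blinfun_eqI)
    (simp add: mult_op_apply series_eq_iff[symmetric] series_ell2_conv series_scaleC algebra_simps)

lemma mult_op_compose: "mult_op x o\<^sub>L mult_op y = mult_op (ell2_conv x y)"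
  by (rule blinfun_eqI)
    (simp add: mult_op_apply series_eq_iff[symmetric] series_ell2_conv algebra_simps)

lemma mult_op_unit: "mult_op (basis_ell2 0) = id_blinfun"
  by (rule blinfun_eqI)
    (simp add: mult_op_apply series_eq_iff[symmetric] series_ell2_conv series_basis_0)

lemma norm_mult_op_le: "norm (mult_op x) \<le> 3 * norm x"
  by (rule norm_blinfun_bound) (simp_all add: mult_op_apply norm_ell2_conv_le)

lemma bounded_linear_mult_op: "bounded_linear mult_op"
proof (rule bounded_linear_intro)
  show "mult_op (r *\<^sub>R x) = r *\<^sub>R mult_op x" for r x
    unfolding scaleR_eq_scaleC mult_op_scaleC
    by (rule blinfun_eqI) (simp add: scaleR_blinfun.rep_eq scaleR_eq_scaleC)
  show "norm (mult_op x) \<le> norm x * 3" for x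
    using norm_mult_op_le[of x] by (simp add: mult.commute)
qed (rule mult_op_add)

text \<open>The unit \<open>basis_ell2 0\<close> has norm 1 and is mapped to \<open>x\<close>.
  Together with \<open>norm_mult_op_le\<close> this makes \<open>mult_op\<close> bicontinuous onto
  its range.\<close>

lemma norm_le_norm_mult_op: "norm x \<le> norm (mult_op x)"
proof -
  have "norm (basis_ell2 0) = 1"
    unfolding norm_ell2_eq basis_ell2.rep_eq by (subst suminf_finite[of "{0}"]) auto
  then show ?thesis using norm_blinfun[of "mult_op x" "basis_ell2 0"] by simp
qed


section \<open>The multiplication algebra\<close>

abbreviation mult_algebra :: "(ell2 \<Rightarrow>\<^sub>L ell2) set" where
  "mult_algebra \<equiv> range mult_op"

lemma id_in_mult_algebra: "id_blinfun \<in> mult_algebra"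
  by (metis mult_op_unit rangeI)

lemma operator_algebra_mult_algebra: "operator_algebra mult_algebra"
proof -
  have "mult_algebra \<subseteq> bounded_operators"
    by (auto simp: bounded_operators_def mult_op_apply series_eq_iff[symmetric] series_ell2_conv
        series_scaleC)
  moreover have "complex_subspace mult_algebra"
    unfolding complex_subspace_def
  proof (intro conjI ballI allI)
    show "0 \<in> mult_algebra"
      using bounded_linear_mult_op by (intro range_eqI[of _ _ 0]) (simp add: linear_simps)
  qed (auto simp: mult_op_add[symmetric] mult_op_scaleC[symmetric])
  moreover have "closed mult_algebra"
  proof -
    \<comment> \<open>The range is the fixed-point set of a continuous map of operators, hence
      closed.\<close>
    have "mult_algebra = {T. mult_op (blinfun_apply T (basis_ell2 0)) = T}"
      by (auto intro: range_eqI[OF sym])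
    also have "closed \<dots>"
      by (intro closed_Collect_eq continuous_intros bounded_linear.continuous_on[OF bounded_linear_mult_op])
    finally show ?thesis .
  qed
  ultimately show ?thesis by (auto simp: operator_algebra_def mult_op_compose)
qed

lemma commutative_algebra_mult_algebra: "commutative_algebra mult_algebra"
  by (auto simp: commutative_algebra_def mult_op_compose series_eq_iff[symmetric] series_ell2_conv
      mult.commute intro!: arg_cong[where f = mult_op])

lemma id_blinfun_compose [simp]: "id_blinfun o\<^sub>L T = T" "T o\<^sub>L id_blinfun = T"
  by (rule blinfun_eqI, simp)+

text \<open>The principal filter at the identity plays the role of a constant net.\<close>

lemma approximately_unital_if_id:
  assumes "id_blinfun \<in> A"
  shows "approximately_unital A"
  unfolding approximately_unital_def
  by (rule exI[of _ "principal {id_blinfun}"])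
    (auto simp: eventually_principal assms norm_blinfun_id_le principal_eq_bot_iff
      intro!: tendsto_eventually)

section \<open>Weak compactness\<close>

lemma openin_weak_topology:
  "\<phi> \<in> bounded_functionals A \<Longrightarrow> open U \<Longrightarrow> openin (weak_topology A) {x \<in> A. \<phi> x \<in> U}"
  unfolding weak_topology_def by (rule topology_generated_by_Basis) blast

lemma topspace_weak_topology: "topspace (weak_topology A) = A"
proof
  show "topspace (weak_topology A) \<subseteq> A"
    unfolding weak_topology_def topology_generated_by_topspace by blast
  have "(\<lambda>_. 0) \<in> bounded_functionals A"
    unfolding bounded_functionals_def by (auto intro!: exI[of _ "0::real"])
  from openin_subset[OF openin_weak_topology[OF this open_UNIV]]
  show "A \<subseteq> topspace (weak_topology A)" by simp
qed

lemma coordinate_functional: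
  "(\<lambda>T. Rep_ell2 (blinfun_apply T (basis_ell2 0)) n) \<in> bounded_functionals A"
proof -
  have "cmod (Rep_ell2 (blinfun_apply T (basis_ell2 0)) n) \<le> norm (basis_ell2 0) * norm T" for T
    using norm_Rep_ell2_le[of "blinfun_apply T (basis_ell2 0)" n] norm_blinfun[of T "basis_ell2 0"]
    by (simp add: mult.commute)
  then show ?thesis
    by (auto simp: bounded_functionals_def plus_ell2.rep_eq scaleC_ell2.rep_eq blinfun.add_left)
qed

text \<open>Coordinates of \<open>T (basis_ell2 0)\<close> are bounded functionals that separate the
  algebra. The result is needed to know that weakly compact sets are weakly closed.\<close>

lemma Hausdorff_weak_topology: "Hausdorff_space (weak_topology mult_algebra)"
  unfolding Hausdorff_space_def topspace_weak_topology
proof clarify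
  fix x y assume "mult_op x \<noteq> mult_op y"
  then obtain n where n: "Rep_ell2 x n \<noteq> Rep_ell2 y n" using ell2_eqI by metis
  then obtain U V where UV: "open U" "open V" "Rep_ell2 x n \<in> U" "Rep_ell2 y n \<in> V" "U \<inter> V = {}"
    using hausdorff by metis
  let ?P = "\<lambda>W. {T \<in> mult_algebra. Rep_ell2 (blinfun_apply T (basis_ell2 0)) n \<in> W}"
  have "openin (weak_topology mult_algebra) (?P U)" "openin (weak_topology mult_algebra) (?P V)"
    using UV by (auto intro!: openin_weak_topology coordinate_functional)
  moreover have "mult_op x \<in> ?P U" "mult_op y \<in> ?P V" "disjnt (?P U) (?P V)"
    using UV by (auto simp: disjnt_def)
  ultimately show "\<exists>U V. openin (weak_topology mult_algebra) U \<and> openin (weak_topology mult_algebra) V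
      \<and> mult_op x \<in> U \<and> mult_op y \<in> V \<and> disjnt U V"
    by (intro exI[of _ "?P U"] exI[of _ "?P V"] conjI)
qed

text \<open>The ball is the image of the compact set \<open>ball_sequences R\<close>. Each
  functional on the algebra pulls back along \<open>mult_op\<close> to one on \<open>ell2\<close>,
  which is an inner product by \<open>riesz_ell2\<close> and hence continuous on that set. A
  negative radius gives the empty set.\<close>

lemma compactin_weak_topology_cball:
  "compactin (weak_topology mult_algebra) (mult_op ` cball 0 R)"
proof (cases "R \<ge> 0")
  case True
  let ?K = "ball_sequences R"
  have "continuous_map (top_of_set ?K) (weak_topology mult_algebra) (\<lambda>f. mult_op (Abs_ell2 f))"
    unfolding weak_topology_def
  proof (rule continuous_on_generated_topo)
    show "(\<lambda>f. mult_op (Abs_ell2 f)) ` topspace (top_of_set ?K)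
      \<subseteq> \<Union> {{x \<in> mult_algebra. \<phi> x \<in> U} | \<phi> U. \<phi> \<in> bounded_functionals mult_algebra \<and> open U}"
      using topspace_weak_topology[of mult_algebra]
      unfolding weak_topology_def topology_generated_by_topspace by (simp add: image_subset_iff)
    fix W
    assume "W \<in> {{x \<in> mult_algebra. \<phi> x \<in> U} | \<phi> U. \<phi> \<in> bounded_functionals mult_algebra \<and> open U}"
    then obtain \<phi> U where W: "W = {x \<in> mult_algebra. \<phi> x \<in> U}" and "open U"
      and \<phi>: "\<phi> \<in> bounded_functionals mult_algebra" by blast
    from \<phi> obtain K where K: "\<And>x. cmod (\<phi> (mult_op x)) \<le> K * norm (mult_op x)"
      unfolding bounded_functionals_def by auto
    obtain y where y: "\<And>x. \<phi> (mult_op x) = cinner x y"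
    \<comment> \<open>The 3 comes from \<open>norm_mult_op_le\<close>; the absolute value guards
      against a negative \<open>K\<close>.\<close>
    proof (rule riesz_ell2[of "\<lambda>x. \<phi> (mult_op x)" "\<bar>K\<bar> * 3"])
      show "\<phi> (mult_op (x + y)) = \<phi> (mult_op x) + \<phi> (mult_op y)" for x y
        using \<phi> unfolding bounded_functionals_def mult_op_add by blast
      show "\<phi> (mult_op (c *\<^sub>C x)) = c * \<phi> (mult_op x)" for c x
        using \<phi> unfolding bounded_functionals_def mult_op_scaleC by blast
      show "cmod (\<phi> (mult_op x)) \<le> \<bar>K\<bar> * 3 * norm x" for x
      proof -
        have "K * norm (mult_op x) \<le> \<bar>K\<bar> * (3 * norm x)"
          by (intro mult_mono norm_mult_op_le) auto
        then show ?thesis using K[of x] by simp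
      qed
    qed (use that in blast)
    have "openin (top_of_set ?K) (?K \<inter> (\<lambda>f. cinner (Abs_ell2 f) y) -` U)"
      using continuous_on_cinner_ball_sequences \<open>open U\<close> by (rule continuous_openin_preimage_gen)
    also have "?K \<inter> (\<lambda>f. cinner (Abs_ell2 f) y) -` U
        = (\<lambda>f. mult_op (Abs_ell2 f)) -` W \<inter> topspace (top_of_set ?K)"
      by (auto simp: W y)
    finally show "openin (top_of_set ?K) ((\<lambda>f. mult_op (Abs_ell2 f)) -` W \<inter> topspace (top_of_set ?K))" .
  qed
  moreover have "compactin (top_of_set ?K) ?K"
    using compact_ball_sequences by (simp add: compactin_subtopology)
  ultimately have "compactin (weak_topology mult_algebra) ((\<lambda>f. mult_op (Abs_ell2 f)) ` ?K)"
    by (intro image_compactin)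
  also have "(\<lambda>f. mult_op (Abs_ell2 f)) ` ?K = mult_op ` cball 0 R"
    using True by (simp add: image_image[symmetric] image_ball_sequences)
  finally show ?thesis .
qed simp

text \<open>Since \<open>mult_op\<close> does not decrease norms, the image of the unit ball lies in
  the encoded ball of radius \<open>norm a * norm a\<close>. That ball is weakly compact and weakly
  closed, so it contains the closure of the image as a closed subset.\<close>

lemma weakly_compact_algebra_mult_algebra: "weakly_compact_algebra mult_algebra"
  unfolding weakly_compact_algebra_def weakly_compact_operator_def
proof
  fix a assume a: "a \<in> mult_algebra"
  let ?W = "weak_topology mult_algebra"
  let ?K = "mult_op ` cball 0 (norm a * norm a)"
  have "(\<lambda>x. a o\<^sub>L x o\<^sub>L a) ` {x \<in> mult_algebra. norm x \<le> 1} \<subseteq> ?K"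
  proof clarify
    fix x assume x: "norm (mult_op x) \<le> 1"
    obtain z where z: "a o\<^sub>L mult_op x o\<^sub>L a = mult_op z"
      using a by (auto simp: mult_op_compose)
    have "norm z \<le> norm (a o\<^sub>L mult_op x o\<^sub>L a)" by (simp add: z norm_le_norm_mult_op)
    also have "\<dots> \<le> norm (a o\<^sub>L mult_op x) * norm a" by (rule norm_blinfun_compose)
    also have "\<dots> \<le> norm a * norm (mult_op x) * norm a"
      by (intro mult_right_mono norm_blinfun_compose) simp
    also have "\<dots> \<le> norm a * 1 * norm a" using x by (intro mult_right_mono mult_left_mono) auto
    finally show "a o\<^sub>L mult_op x o\<^sub>L a \<in> ?K" by (simp add: z)
  qed
  moreover have "compactin ?W ?K" by (rule compactin_weak_topology_cball)
  moreover from this have "closedin ?W ?K"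
    by (rule compactin_imp_closedin[OF Hausdorff_weak_topology])
  ultimately show "compactin ?W (?W closure_of ((\<lambda>x. a o\<^sub>L x o\<^sub>L a) ` {x \<in> mult_algebra. norm x \<le> 1}))"
    using closed_compactin[OF _ closure_of_minimal closedin_closure_of] by blast
qed

section \<open>Point evaluations\<close>

text \<open>The coefficients are bounded by \<open>norm x\<close>, so inside the unit disc a
  geometric series dominates.\<close>

lemma fps_conv_radius_series: "1 \<le> fps_conv_radius (series x)"
  unfolding fps_conv_radius_def one_ereal_def
proof (rule conv_radius_geI_ex')
  fix r :: real assume r: "0 < r" "ereal r < ereal 1"
  have "norm (fps_nth (series x) n * of_real r ^ n) \<le> norm x * r ^ n" for n
  proof -
    have "cmod (Rep_ell2 x n) / real (Suc n) \<le> cmod (Rep_ell2 x n) / 1"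
      by (intro divide_left_mono) auto
    also have "\<dots> \<le> norm x" by (simp add: norm_Rep_ell2_le)
    finally have "cmod (Rep_ell2 x n) / real (Suc n) * r ^ n \<le> norm x * r ^ n"
      using r by (intro mult_right_mono) auto
    then show ?thesis
      using r by (simp add: series_def norm_mult norm_divide norm_power norm_of_nat del: of_nat_Suc)
  qed
  moreover have "summable (\<lambda>n. norm x * r ^ n)"
    using r by (intro summable_mult summable_geometric) auto
  ultimately show "summable (\<lambda>n. fps_nth (series x) n * of_real r ^ n)"
    by (rule summable_comparison_test'[rotated])
qed

lemma less_fps_conv_radius_series: "cmod z < 1 \<Longrightarrow> ereal (cmod z) < fps_conv_radius (series x)"
  using fps_conv_radius_series[of x] by (metis ereal_less(3) less_le_trans ereal_less_eq(3) less_ereal.simps(1) one_ereal_def)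

text \<open>The power series is read off from the value at the unit, and \<open>restrict\<close>
  provides the extensional form required by \<open>characters\<close>.\<close>

definition point_eval :: "complex \<Rightarrow> (ell2 \<Rightarrow>\<^sub>L ell2) \<Rightarrow> complex" where
  "point_eval z = restrict (\<lambda>T. eval_fps (series (blinfun_apply T (basis_ell2 0))) z) mult_algebra"

lemma point_eval_mult_op: "point_eval z (mult_op x) = eval_fps (series x) z"
  by (simp add: point_eval_def)

lemma point_eval_unit: "point_eval z id_blinfun = 1"
  unfolding mult_op_unit[symmetric] by (simp add: point_eval_mult_op series_basis_0 del: mult_op_basis_0)

lemma point_eval_shift: "point_eval z (mult_op (2 *\<^sub>C basis_ell2 1)) = z"
  unfolding point_eval_mult_op series_eq_fps_X by simp

context
  fixes z :: complex
  assumes z: "cmod z < 1"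
begin

lemma point_eval_add:
  assumes "S \<in> mult_algebra" "T \<in> mult_algebra"
  shows "point_eval z (S + T) = point_eval z S + point_eval z T"
  using assms by (auto simp: mult_op_add[symmetric] point_eval_mult_op series_add eval_fps_add
      less_fps_conv_radius_series z)

lemma point_eval_scale:
  assumes "T \<in> mult_algebra"
  shows "point_eval z (op_scale c T) = c * point_eval z T"
  using assms by (auto simp: mult_op_scaleC[symmetric] point_eval_mult_op series_scaleC eval_fps_mult
      less_fps_conv_radius_series z)

lemma point_eval_compose:
  assumes "S \<in> mult_algebra" "T \<in> mult_algebra"
  shows "point_eval z (S o\<^sub>L T) = point_eval z S * point_eval z T"
  using assms by (auto simp: mult_op_compose point_eval_mult_op series_ell2_conv eval_fps_mult
      less_fps_conv_radius_series z)

lemma point_eval_in_characters: "point_eval z \<in> characters mult_algebra"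
proof -
  have "point_eval z \<in> extensional mult_algebra" by (simp add: point_eval_def)
  moreover have "\<exists>T\<in>mult_algebra. point_eval z T \<noteq> 0"
    using id_in_mult_algebra point_eval_unit by (metis zero_neq_one)
  ultimately show ?thesis
    unfolding characters_def using point_eval_add point_eval_scale point_eval_compose by blast
qed

end

section \<open>Kernels of characters and semisimplicity\<close>

lemma op_scale_minus_one: "op_scale (- 1) T = - T"
proof (rule blinfun_eqI)
  fix x
  have "(- 1) *\<^sub>C blinfun_apply T x = (- 1) *\<^sub>R blinfun_apply T x"
    by (simp only: scaleR_eq_scaleC) simp
  then show "blinfun_apply (op_scale (- 1) T) x = blinfun_apply (- T) x"
    by (simp add: blinfun.minus_left)
qed

text \<open>The kernel of a character has codimension one, which gives maximality; the identity
  serves as modular unit, because then \<open>a - (a o\<^sub>L u)\<close> vanishes.\<close>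

lemma maximal_modular_left_ideal_ker:
  assumes A: "operator_algebra A" and id: "id_blinfun \<in> A" and h: "h \<in> characters A"
  shows "maximal_modular_left_ideal A {a \<in> A. h a = 0}"
proof -
  let ?I = "{a \<in> A. h a = 0}"
  have V: "complex_subspace A" and comp: "\<And>a b. a \<in> A \<Longrightarrow> b \<in> A \<Longrightarrow> a o\<^sub>L b \<in> A"
    using A by (auto simp: operator_algebra_def)
  have scale: "op_scale c a \<in> A" "h (op_scale c a) = c * h a" if "a \<in> A" for c a
    using V h that by (auto simp: complex_subspace_def characters_def)
  have add: "a + b \<in> A" "h (a + b) = h a + h b" if "a \<in> A" "b \<in> A" for a b
    using V h that by (auto simp: complex_subspace_def characters_def)
  have mult: "h (a o\<^sub>L b) = h a * h b" if "a \<in> A" "b \<in> A" for a b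
    using h that by (auto simp: characters_def)
  have zero: "0 \<in> A" using V by (simp add: complex_subspace_def)
  have h0: "h 0 = 0" using add(2)[OF zero zero] by simp
  have ideal: "left_ideal A ?I"
    using zero h0 by (auto simp: left_ideal_def complex_subspace_def add scale mult comp)
  moreover have "?I \<noteq> A" using h by (auto simp: characters_def)
  moreover have "\<exists>u\<in>A. \<forall>a\<in>A. a - (a o\<^sub>L u) \<in> ?I"
    using id zero h0 by (intro bexI[of _ id_blinfun]) auto
  moreover have "J = ?I" if J: "left_ideal A J" "?I \<subseteq> J" "J \<noteq> A" for J
  proof (rule ccontr)
    assume "J \<noteq> ?I"
    moreover have JA: "J \<subseteq> A" "complex_subspace J" using J by (auto simp: left_ideal_def)
    ultimately obtain b where b: "b \<in> J" "b \<in> A" "h b \<noteq> 0" using J(2) by blast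
    have "a \<in> J" if a: "a \<in> A" for a
    proof -
      \<comment> \<open>This multiple of \<open>b\<close> has the same value under \<open>h\<close>
        as \<open>a\<close>, so their difference is in the kernel. The difference is written with
        \<open>op_scale (- 1)\<close> because characters are only known to respect sums, complex
        multiples and products.\<close>
      let ?c = "op_scale (h a / h b) b"
      have "a + op_scale (- 1) ?c \<in> ?I" using a b by (simp add: add scale)
      then have "a - ?c \<in> J" using J(2) by (auto simp: op_scale_minus_one)
      moreover have "?c \<in> J" using JA b by (auto simp: complex_subspace_def)
      ultimately have "(a - ?c) + ?c \<in> J" using JA by (auto simp only: complex_subspace_def)
      then show ?thesis by simp
    qed
    then show False using J(3) JA by blast
  qed
  ultimately show ?thesis unfolding maximal_modular_left_ideal_def by blast
qed

text \<open>An element of the radical lies in the kernel of every point evaluation in the disc. Its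
  power series therefore vanishes near 0, and the identity theorem makes all coefficients
  zero.\<close>

lemma semisimple_mult_algebra: "semisimple_algebra mult_algebra"
  unfolding semisimple_algebra_def
proof
  have zero: "0 \<in> mult_algebra"
    using operator_algebra_mult_algebra by (simp add: operator_algebra_def complex_subspace_def)
  then show "{0} \<subseteq> jacobson_radical mult_algebra"
    by (auto simp: jacobson_radical_def maximal_modular_left_ideal_def left_ideal_def complex_subspace_def)
  show "jacobson_radical mult_algebra \<subseteq> {0}"
  proof
    fix a assume a: "a \<in> jacobson_radical mult_algebra"
    then obtain x where x: "a = mult_op x" by (auto simp: jacobson_radical_def)
    have "eval_fps (series x) z = 0" if z: "cmod z < 1" for z
    proof -
      have "maximal_modular_left_ideal mult_algebra {a \<in> mult_algebra. point_eval z a = 0}"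
        by (intro maximal_modular_left_ideal_ker operator_algebra_mult_algebra id_in_mult_algebra
            point_eval_in_characters z)
      then have "point_eval z a = 0" using a unfolding jacobson_radical_def by blast
      then show ?thesis by (simp add: x point_eval_mult_op)
    qed
    then have "\<forall>\<^sub>F z in nhds 0. eval_fps (series x) z = eval_fps 0 z"
      unfolding eventually_nhds by (intro exI[of _ "ball 0 1"]) (auto simp: dist_norm)
    moreover have "0 < fps_conv_radius (series x)" using less_fps_conv_radius_series[of 0 x] by (simp add: zero_ereal_def)
    ultimately have "series x = series 0" unfolding series_0 by (intro eval_fps_eqD) simp_all
    then have "x = 0" by (simp add: series_eq_iff)
    then show "a \<in> {0}" by (simp add: x linear_0[OF bounded_linear.linear[OF bounded_linear_mult_op]])
  qed
qed

section \<open>The unit disc inside the maximal ideal space\<close>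

lemma inj_point_eval: "inj point_eval"
  by (metis injI point_eval_shift)

lemma point_eval_image_subset:
  "point_eval ` ball 0 1 \<subseteq> topspace (maximal_ideal_space mult_algebra)"
  using point_eval_in_characters
  by (auto simp: maximal_ideal_space_def topspace_product_topology characters_def
      PiE_def dist_norm)

lemma uncountable_characters: "\<not> countable (topspace (maximal_ideal_space mult_algebra))"
proof
  assume "countable (topspace (maximal_ideal_space mult_algebra))"
  then have "countable (point_eval ` ball 0 1)"
    using point_eval_image_subset countable_subset by blast
  then have "countable (ball (0::complex) 1)"
    using countable_image_inj_on inj_point_eval inj_on_subset by blast
  then show False using uncountable_ball[of 1 "0::complex"] by simp
qed

text \<open>The target carries the topology of pointwise convergence, so it suffices to fix one
  element; there the claim is continuity of a power series inside its disc of convergence.\<close>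

lemma continuous_map_point_eval:
  "continuous_map (top_of_set (ball 0 1)) (maximal_ideal_space mult_algebra) point_eval"
  unfolding maximal_ideal_space_def
proof (rule continuous_map_into_subtopology)
  have "continuous_on (ball 0 1) (\<lambda>z. point_eval z T)" if T: "T \<in> mult_algebra" for T
  proof -
    obtain x where "T = mult_op x" using T by (rule rangeE)
    moreover have "continuous_on (ball 0 1) (eval_fps (series x))"
      by (rule continuous_on_subset[OF continuous_on_eval_fps])
        (auto simp: in_eball_iff dist_norm less_fps_conv_radius_series)
    ultimately show ?thesis by (simp add: point_eval_mult_op)
  qed
  then show "continuous_map (top_of_set (ball 0 1)) (product_topology (\<lambda>_. euclidean) mult_algebra) point_eval"
    by (auto simp: continuous_map_componentwise point_eval_def)
  show "point_eval \<in> topspace (top_of_set (ball 0 1)) \<rightarrow> characters mult_algebra"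
    using point_eval_in_characters by (auto simp: dist_norm)
qed

text \<open>The image of the disc has no isolated point: by continuity and injectivity of
  \<open>point_eval\<close>, one would pull back to an open singleton in the plane.\<close>

lemma not_scattered_maximal_ideal_space: "\<not> scattered_space (maximal_ideal_space mult_algebra)"
proof
  let ?X = "maximal_ideal_space mult_algebra" and ?S = "point_eval ` ball 0 1"
  assume "scattered_space ?X"
  then obtain h where "h \<in> ?S" and h: "openin (subtopology ?X ?S) {h}"
    unfolding scattered_space_def using point_eval_image_subset by (metis ball_eq_empty image_is_empty not_one_le_zero)
  then obtain z where z: "h = point_eval z" "z \<in> ball 0 1" by blast
  have "continuous_map (top_of_set (ball 0 1)) (subtopology ?X ?S) point_eval"
    by (rule continuous_map_into_subtopology[OF continuous_map_point_eval]) auto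
  from openin_continuous_map_preimage[OF this h]
  have "openin (top_of_set (ball 0 1)) {w \<in> ball 0 1. point_eval w \<in> {h}}" by simp
  also have "{w \<in> ball 0 1. point_eval w \<in> {h}} = {z}"
    using z inj_point_eval by (auto dest: injD)
  finally have "open {z}" by (simp add: openin_open_eq)
  then show False using not_open_singleton by blast
qed

section \<open>The spectrum of multiplication by the variable\<close>

lemma spectrum_in_with_id:
  assumes "id_blinfun \<in> A"
  shows "spectrum_in A a = unital_spectrum A id_blinfun a"
proof -
  have unit: "is_unit_of A id_blinfun" using assms by (simp add: is_unit_of_def)
  moreover have "e = id_blinfun" if "is_unit_of A e" for e
    using that assms by (metis id_blinfun_compose(1) is_unit_of_def)
  ultimately have "(THE e. is_unit_of A e) = id_blinfun" by (rule the_equality)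
  then show ?thesis using unit unfolding spectrum_in_def by auto
qed

text \<open>Evaluation at \<open>z\<close> sends the variable to \<open>z\<close> and hence
  annihilates \<open>z\<close> minus the variable. An inverse would thus give 0 = 1.\<close>

lemma ball_subset_spectrum_shift:
  "ball 0 1 \<subseteq> spectrum_in mult_algebra (mult_op (2 *\<^sub>C basis_ell2 1))"
  unfolding spectrum_in_with_id[OF id_in_mult_algebra] unital_spectrum_def
proof clarify
  fix z :: complex and b
  let ?a = "mult_op (2 *\<^sub>C basis_ell2 1)" and ?zI = "op_scale z (id_blinfun :: ell2 \<Rightarrow>\<^sub>L ell2)"
  assume z: "z \<in> ball 0 1" and b: "(?zI - ?a) o\<^sub>L mult_op b = id_blinfun"
  from z have z': "cmod z < 1" by (simp add: dist_norm)
  have zI: "?zI \<in> mult_algebra" and am: "op_scale (- 1) ?a \<in> mult_algebra"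
    by (metis mult_op_unit mult_op_scaleC rangeI)+
  then have mem: "?zI + op_scale (- 1) ?a \<in> mult_algebra"
    by (auto simp: mult_op_add[symmetric])
  \<comment> \<open>The difference is again expressed as a sum with \<open>op_scale (- 1)\<close>,
    so that additivity and homogeneity of \<open>point_eval\<close> apply.\<close>
  have "point_eval z ((?zI + op_scale (- 1) ?a) o\<^sub>L mult_op b) = 0"
    using zI am mem z'
    by (simp add: point_eval_compose point_eval_add point_eval_scale id_in_mult_algebra
        point_eval_unit point_eval_shift del: One_nat_def)
  then show False using b by (simp add: op_scale_minus_one point_eval_unit)
qed

theorem mainTheorem5:
  shows "\<exists>A :: (ell2 \<Rightarrow>\<^sub>L ell2) set.
    operator_algebra A \<and> approximately_unital A \<and> commutative_algebra A \<and>
    weakly_compact_algebra A \<and> semisimple_algebra A \<and>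
    \<not> countable (topspace (maximal_ideal_space A)) \<and>
    \<not> scattered_space (maximal_ideal_space A) \<and>
    (\<exists>a\<in>A. interior (spectrum_in A a) \<noteq> {})"
proof (rule exI[of _ mult_algebra], intro conjI)
  show "operator_algebra mult_algebra" by (rule operator_algebra_mult_algebra)
  show "approximately_unital mult_algebra"
    by (rule approximately_unital_if_id[OF id_in_mult_algebra])
  show "commutative_algebra mult_algebra" by (rule commutative_algebra_mult_algebra)
  show "weakly_compact_algebra mult_algebra" by (rule weakly_compact_algebra_mult_algebra)
  show "semisimple_algebra mult_algebra" by (rule semisimple_mult_algebra)
  show "\<not> countable (topspace (maximal_ideal_space mult_algebra))" by (rule uncountable_characters)
  show "\<not> scattered_space (maximal_ideal_space mult_algebra)"
    by (rule not_scattered_maximal_ideal_space)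
  show "\<exists>a\<in>mult_algebra. interior (spectrum_in mult_algebra a) \<noteq> {}"
  proof (rule bexI[of _ "mult_op (2 *\<^sub>C basis_ell2 1)"])
    have "ball 0 1 \<subseteq> interior (spectrum_in mult_algebra (mult_op (2 *\<^sub>C basis_ell2 1)))"
      by (intro interior_maximal ball_subset_spectrum_shift open_ball)
    moreover have "(0::complex) \<in> ball 0 1" by simp
    ultimately show "interior (spectrum_in mult_algebra (mult_op (2 *\<^sub>C basis_ell2 1))) \<noteq> {}"
      by blast
  qed (rule rangeI)
qed

end
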